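(* Let $T$ be a full binary tree with $k$ leaves and let the leaf values $p_1,\dots,p_k$ be i.i.d. real random variables with $\mathbb E_p[p_i]=\mu$ and $\operatorname{Var}_p(p_i)=\tau^2$. Define $$\Lambda_1(T)=\sum_{v\in\operatorname{int}(T)}|\mathcal L(v)|,\qquad \Lambda_2(T)=\sum_{v\in\operatorname{int}(T)}|\mathcal L(v)|^2.$$ Then, with $K_T$ the common-ancestor kernel of $T$ and $M=\mathbb E_p[pp^\top]$, $$\langle K_T,M\rangle=\tau^2\Lambda_1(T)+\mu^2\Lambda_2(T).$$ Including rounded product leaves, the leading second moment under the constant-$\nu$ model is $$\nu_pu_p^2\,k(\tau^2+\mu^2)+\nu_au_a^2\{\tau^2\Lambda_1(T)+\mu^2\Lambda_2(T)\}.$$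
   Context: A full binary tree is one in which every internal node has exactly two children. $\operatorname{int}(T)$ is the set of internal nodes of $T$; $\mathcal L(v)$ is the set of leaves below $v$; $q_v=\sum_{i\in\mathcal L(v)}p_i$ is the exact partial sum at $v$. The common-ancestor kernel is the $k\times k$ matrix with entries $(K_T)_{ij}=\#\{v\in\operatorname{int}(T): i,j\in\mathcal L(v)\}$. $\langle X,Y\rangle=\operatorname{tr}(X^\top Y)$. In the constant-$\nu$ model, with product and accumulation unit roundoffs $u_p,u_a$ and nonnegative coefficients $\nu_p,\nu_a$, a rounding at an internal node with pre-rounding operand $x$ has conditional variance $\nu_au_a^2x^2$ and a rounded product leaf has error variance $\nu_pu_p^2p_i^2$. For fixed $p$ the leading-order root error second moment is $\nu_pu_p^2\sum_{i=1}^kp_i^2+\nu_au_a^2\sum_{v\in\operatorname{int}(T)}q_v^2$; "the leading second moment" in the claim is the expectation over $p$ of this expression. *)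

theory Defs
  imports "HOL-Probability.Probability"
begin

text \<open>Every internal node has exactly two children by construction; leaves carry the index of
  their summand.\<close>

datatype 'i btree = Leaf 'i | Node "'i btree" "'i btree"

fun leaf_list :: "'i btree \<Rightarrow> 'i list" where
  "leaf_list (Leaf i) = [i]"
| "leaf_list (Node l r) = leaf_list l @ leaf_list r"

definition leaves :: "'i btree \<Rightarrow> 'i set" where
  "leaves v = set (leaf_list v)"

text \<open>For an index type of \<open>k\<close> elements: the tree has exactly \<open>k\<close> leaves, and the leaves are in
  bijection with the indices.\<close>

definition leaf_indexed :: "'i btree \<Rightarrow> bool" where
  "leaf_indexed T \<longleftrightarrow> distinct (leaf_list T) \<and> leaves T = UNIV"

text \<open>A node is represented by the subtree rooted at it. If the leaf indices are pairwise distinct,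
  different nodes have different subtrees, so no two nodes are identified
  (see \<open>card_int_nodes\<close>).\<close>

fun int_nodes :: "'i btree \<Rightarrow> 'i btree set" where
  "int_nodes (Leaf i) = {}"
| "int_nodes (Node l r) = insert (Node l r) (int_nodes l \<union> int_nodes r)"

definition partial_sum :: "('i \<Rightarrow> real) \<Rightarrow> 'i btree \<Rightarrow> real" where
  "partial_sum x v = (\<Sum>i\<in>leaves v. x i)"

definition ca_kernel :: "'k::finite btree \<Rightarrow> real^'k^'k" where
  "ca_kernel T = (\<chi> i j. real (card {v \<in> int_nodes T. i \<in> leaves v \<and> j \<in> leaves v}))"

definition frob_inner :: "real^'n^'m \<Rightarrow> real^'n^'m \<Rightarrow> real" where
  "frob_inner X Y = trace (transpose X ** Y)"

definition Lambda1 :: "'i btree \<Rightarrow> real" where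
  "Lambda1 T = (\<Sum>v\<in>int_nodes T. real (card (leaves v)))"

definition Lambda2 :: "'i btree \<Rightarrow> real" where
  "Lambda2 T = (\<Sum>v\<in>int_nodes T. (real (card (leaves v)))\<^sup>2)"

text \<open>The matrix of expectations of the entries of \<open>p p\<^sup>T\<close>.\<close>

definition second_moment_matrix :: "'w measure \<Rightarrow> ('k::finite \<Rightarrow> 'w \<Rightarrow> real) \<Rightarrow> real^'k^'k" where
  "second_moment_matrix P p = (\<chi> i j. \<integral>\<omega>. p i \<omega> * p j \<omega> \<partial>P)"

text \<open>Error variances in the constant-\<open>\<nu>\<close> model: \<open>\<nu> u\<^sup>2 x\<^sup>2\<close> for one rounding with coefficient
  \<open>\<nu>\<close>, unit roundoff \<open>u\<close> and operand \<open>x\<close>. To leading order, the operand at an internal node is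
  its exact partial sum, and the error second moment at the root is the sum of the variances of all
  product leaves and all internal nodes.\<close>

definition rounding_var :: "real \<Rightarrow> real \<Rightarrow> real \<Rightarrow> real" where
  "rounding_var nu u x = nu * u\<^sup>2 * x\<^sup>2"

definition root_error_moment ::
    "real \<Rightarrow> real \<Rightarrow> real \<Rightarrow> real \<Rightarrow> 'k::finite btree \<Rightarrow> ('k \<Rightarrow> real) \<Rightarrow> real" where
  "root_error_moment nu_p u_p nu_a u_a T x =
     (\<Sum>i\<in>UNIV. rounding_var nu_p u_p (x i)) +
     (\<Sum>v\<in>int_nodes T. rounding_var nu_a u_a (partial_sum x v))"

text \<open>The expectation is over the leaf values.\<close>

definition leading_second_moment ::
    "real \<Rightarrow> real \<Rightarrow> real \<Rightarrow> real \<Rightarrow> 'k::finite btree \<Rightarrow> 'w measure \<Rightarrow> ('k \<Rightarrow> 'w \<Rightarrow> real) \<Rightarrow> real" where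
  "leading_second_moment nu_p u_p nu_a u_a T P p =
     (\<integral>\<omega>. root_error_moment nu_p u_p nu_a u_a T (\<lambda>i. p i \<omega>) \<partial>P)"

lemma finite_int_nodes: "finite (int_nodes T)"
  by (induction T) auto

lemma leaves_nonempty: "leaves T \<noteq> {}"
  unfolding leaves_def by (induction T) auto

lemma leaves_int_nodes: "v \<in> int_nodes T \<Longrightarrow> leaves v \<subseteq> leaves T"
  unfolding leaves_def by (induction T) auto

lemma size_int_nodes: "v \<in> int_nodes T \<Longrightarrow> size v \<le> size T"
  by (induction T) auto

lemma card_int_nodes:
  "distinct (leaf_list T) \<Longrightarrow> Suc (card (int_nodes T)) = length (leaf_list T)"
proof (induction T)
  case (Leaf i)
  then show ?case by simp
next
  case (Node l r)
  have disj: "leaves l \<inter> leaves r = {}"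
    using Node.prems by (simp add: leaves_def)
  have "int_nodes l \<inter> int_nodes r = {}"
  proof (rule ccontr)
    assume "int_nodes l \<inter> int_nodes r \<noteq> {}"
    then obtain v where "v \<in> int_nodes l" "v \<in> int_nodes r" by blast
    then have "leaves v \<subseteq> leaves l \<inter> leaves r" using leaves_int_nodes by blast
    then show False using disj leaves_nonempty[of v] by simp
  qed
  moreover have "Node l r \<notin> int_nodes l \<union> int_nodes r"
    using size_int_nodes[of "Node l r"] by fastforce
  ultimately show ?case
    using Node by (simp add: card_Un_disjoint finite_int_nodes)
qed

end

theory Submission
  imports Defs
begin

text \<open>The kernel is a sum, over internal nodes \<open>v\<close>, of outer products of the
  indicator vector of \<open>leaves v\<close> with itself. Pairing it with a matrix \<open>Y\<close>
  therefore adds up the blocks of \<open>Y\<close> on \<open>leaves v\<close> times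
  \<open>leaves v\<close> (\<open>frob_inner_ca_kernel\<close>). Independence makes the second
  moment matrix equal to \<open>\<tau>\<^sup>2\<close> times the identity plus
  \<open>\<mu>\<^sup>2\<close> times the all-ones matrix
  (\<open>expectation_mult_indep_vars\<close>), so a block with n leaves contributes
  \<open>\<tau>\<^sup>2\<close> n + \<open>\<mu>\<^sup>2\<close> n^2. The same block sum is the
  expectation of the squared partial sum at \<open>v\<close>, so linearity of expectation gives the
  error moment as well.\<close>

lemma frob_inner_eq_sum: "frob_inner X Y = (\<Sum>i\<in>UNIV. \<Sum>j\<in>UNIV. X $ i $ j * Y $ i $ j)"
  unfolding frob_inner_def trace_def transpose_def matrix_matrix_mult_def
  by (simp, subst sum.swap, simp)

text \<open>Double counting: each kernel entry counts nodes, and exchanging the finite sums puts the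
  node outermost.\<close>

lemma frob_inner_ca_kernel:
  "frob_inner (ca_kernel T) Y = (\<Sum>v\<in>int_nodes T. \<Sum>i\<in>leaves v. \<Sum>j\<in>leaves v. Y $ i $ j)"
proof -
  \<comment> \<open>The cardinality becomes a sum of indicators. Nesting the two tests, with the one
    free of \<open>j\<close> outside, lets the sums over \<open>j\<close> and then \<open>i\<close>
    be restricted one at a time.\<close>
  have kernel: "ca_kernel T $ i $ j * Y $ i $ j =
      (\<Sum>v\<in>int_nodes T. if i \<in> leaves v then if j \<in> leaves v then Y $ i $ j else 0 else 0)" for i j
  proof -
    have "(\<Sum>v\<in>int_nodes T. if i \<in> leaves v then if j \<in> leaves v then Y $ i $ j else 0 else 0) =
        (\<Sum>v\<in>{v \<in> int_nodes T. i \<in> leaves v \<and> j \<in> leaves v}. Y $ i $ j)"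
      by (subst sum.inter_filter[OF finite_int_nodes]) (auto intro: sum.cong)
    then show ?thesis
      by (simp add: ca_kernel_def)
  qed
  have "frob_inner (ca_kernel T) Y = (\<Sum>i\<in>UNIV. \<Sum>v\<in>int_nodes T. \<Sum>j\<in>UNIV.
      if i \<in> leaves v then if j \<in> leaves v then Y $ i $ j else 0 else 0)"
    unfolding frob_inner_eq_sum kernel by (subst sum.swap) simp
  also have "\<dots> = (\<Sum>v\<in>int_nodes T. \<Sum>i\<in>UNIV. \<Sum>j\<in>UNIV.
      if i \<in> leaves v then if j \<in> leaves v then Y $ i $ j else 0 else 0)"
    by (rule sum.swap)
  also have "\<dots> = (\<Sum>v\<in>int_nodes T. \<Sum>i\<in>leaves v. \<Sum>j\<in>leaves v. Y $ i $ j)"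
  proof (rule sum.cong[OF refl])
    fix v :: "'a btree"
    have "(\<Sum>j\<in>UNIV. if i \<in> leaves v then if j \<in> leaves v then Y $ i $ j else 0 else 0) =
        (if i \<in> leaves v then \<Sum>j\<in>leaves v. Y $ i $ j else 0)" for i
      by (simp add: sum.If_cases)
    then show "(\<Sum>i\<in>UNIV. \<Sum>j\<in>UNIV. if i \<in> leaves v then if j \<in> leaves v then Y $ i $ j else 0 else 0) =
        (\<Sum>i\<in>leaves v. \<Sum>j\<in>leaves v. Y $ i $ j)"
      by (simp add: sum.If_cases)
  qed
  finally show ?thesis .
qed

text \<open>Only the diagonal pairs carry \<open>a\<close>, while every pair carries
  \<open>b\<close>; this is where the linear and quadratic leaf counts of \<open>Lambda1\<close> and
  \<open>Lambda2\<close> come from.\<close>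

lemma sum_sum_diagonal_plus_const:
  fixes a b :: real
  assumes "finite A"
  shows "(\<Sum>i\<in>A. \<Sum>j\<in>A. (if i = j then a else 0) + b) = a * real (card A) + b * (real (card A))\<^sup>2"
  using assms by (simp add: sum.distrib power2_eq_square algebra_simps)

text \<open>The product is dominated by the sum of the squares; no independence is involved, so
  equal factors are covered too.\<close>

lemma integrable_mult_of_square_integrable:
  fixes X Y :: "'a \<Rightarrow> real"
  assumes [measurable]: "X \<in> borel_measurable M" "Y \<in> borel_measurable M"
    and X: "integrable M (\<lambda>\<omega>. (X \<omega>)\<^sup>2)" and Y: "integrable M (\<lambda>\<omega>. (Y \<omega>)\<^sup>2)"
  shows "integrable M (\<lambda>\<omega>. X \<omega> * Y \<omega>)"
proof (rule Bochner_Integration.integrable_bound)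
  show "integrable M (\<lambda>\<omega>. (X \<omega>)\<^sup>2 + (Y \<omega>)\<^sup>2)"
    using X Y by simp
  have "\<bar>x * y\<bar> \<le> x\<^sup>2 + y\<^sup>2" for x y :: real
    \<comment> \<open>The first fact bounds twice \<open>\<bar>x\<bar> * \<bar>y\<bar>\<close>;
      nonnegativity of that product allows dropping the factor 2.\<close>
    using sum_squares_bound[of "\<bar>x\<bar>" "\<bar>y\<bar>"] mult_nonneg_nonneg[of "\<bar>x\<bar>" "\<bar>y\<bar>"]
    unfolding abs_mult power2_abs by linarith
  then show "AE \<omega> in M. norm (X \<omega> * Y \<omega>) \<le> norm ((X \<omega>)\<^sup>2 + (Y \<omega>)\<^sup>2)"
    by simp
qed measurable

text \<open>On the diagonal this is variance plus squared mean; off the diagonal the expectation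
  factors by independence. Here \<open>\<sigma>\<close> is the variance itself.\<close>

lemma (in prob_space) expectation_mult_indep_vars:
  fixes X :: "'i \<Rightarrow> 'a \<Rightarrow> real"
  assumes indep: "indep_vars (\<lambda>_. borel) X I" and ij: "i \<in> I" "j \<in> I"
    and sq: "\<And>i. i \<in> I \<Longrightarrow> integrable M (\<lambda>\<omega>. (X i \<omega>)\<^sup>2)"
    and mean: "\<And>i. i \<in> I \<Longrightarrow> expectation (X i) = \<mu>"
    and var: "\<And>i. i \<in> I \<Longrightarrow> variance (X i) = \<sigma>"
  shows "expectation (\<lambda>\<omega>. X i \<omega> * X j \<omega>) = (if i = j then \<sigma> else 0) + \<mu>\<^sup>2"
proof -
  have meas: "random_variable borel (X i)" if "i \<in> I" for i
    using indep that by (auto simp: indep_vars_def)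
  have int: "integrable M (X i)" if "i \<in> I" for i
    using square_integrable_imp_integrable[OF meas sq] that by blast
  show ?thesis
  proof (cases "i = j")
    case True
    then show ?thesis
      using variance_eq[OF int sq, of j] mean[of j] var[of j] ij by (simp add: power2_eq_square)
  next
    case False
    \<comment> \<open>Independence of the family is applied to the subfamily \<open>{i, j}\<close>,
      whose product has two factors because \<open>i \<noteq> j\<close>.\<close>
    have "expectation (\<lambda>\<omega>. \<Prod>k\<in>{i, j}. X k \<omega>) = (\<Prod>k\<in>{i, j}. expectation (X k))"
      using ij by (intro indep_vars_lebesgue_integral indep_vars_subset[OF indep] int) auto
    then show ?thesis
      using mean ij False by (simp add: power2_eq_square)
  qed
qed

theorem corollary2p5:
  fixes T :: "'k::finite btree"
    and P :: "'w measure"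
    and p :: "'k \<Rightarrow> 'w \<Rightarrow> real"
    and \<mu> \<tau> nu_p u_p nu_a u_a :: real
  assumes tree: "leaf_indexed T"
    and prob: "prob_space P"
    and indep: "prob_space.indep_vars P (\<lambda>_. borel) p UNIV"
    and ident: "\<And>i j. distr P borel (p i) = distr P borel (p j)"
    and square_integrable: "\<And>i. integrable P (\<lambda>\<omega>. (p i \<omega>)\<^sup>2)"
    and mean: "\<And>i. prob_space.expectation P (p i) = \<mu>"
    and var: "\<And>i. prob_space.variance P (p i) = \<tau>\<^sup>2"
    and nu_nonneg: "0 \<le> nu_p" "0 \<le> nu_a"
  shows "frob_inner (ca_kernel T) (second_moment_matrix P p) = \<tau>\<^sup>2 * Lambda1 T + \<mu>\<^sup>2 * Lambda2 T
       \<and> leading_second_moment nu_p u_p nu_a u_a T P p =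
           nu_p * u_p\<^sup>2 * real CARD('k) * (\<tau>\<^sup>2 + \<mu>\<^sup>2)
           + nu_a * u_a\<^sup>2 * (\<tau>\<^sup>2 * Lambda1 T + \<mu>\<^sup>2 * Lambda2 T)"
proof -
  interpret prob_space P by (rule prob)
  have meas: "random_variable borel (p i)" for i
    using indep by (auto simp: indep_vars_def)
  have prod_int: "integrable P (\<lambda>\<omega>. p i \<omega> * p j \<omega>)" for i j
    by (intro integrable_mult_of_square_integrable meas square_integrable)
  have prod_exp: "expectation (\<lambda>\<omega>. p i \<omega> * p j \<omega>) = (if i = j then \<tau>\<^sup>2 else 0) + \<mu>\<^sup>2" for i j
    using expectation_mult_indep_vars[OF indep _ _ square_integrable mean var] by simp
  have leaf: "expectation (\<lambda>\<omega>. (p i \<omega>)\<^sup>2) = \<tau>\<^sup>2 + \<mu>\<^sup>2" for i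
    using prod_exp[of i i] by (simp add: power2_eq_square)
  \<comment> \<open>This expansion links the two claims: its expectation is the block sum that the
    kernel extracts at \<open>v\<close>.\<close>
  have sq_sum: "(partial_sum (\<lambda>i. p i \<omega>) v)\<^sup>2 = (\<Sum>i\<in>leaves v. \<Sum>j\<in>leaves v. p i \<omega> * p j \<omega>)" for v \<omega>
    by (simp add: partial_sum_def power2_eq_square sum_product)
  have node_int: "integrable P (\<lambda>\<omega>. (partial_sum (\<lambda>i. p i \<omega>) v)\<^sup>2)" for v
    unfolding sq_sum by (intro Bochner_Integration.integrable_sum prod_int)
  have entries: "(\<Sum>i\<in>leaves v. \<Sum>j\<in>leaves v. expectation (\<lambda>\<omega>. p i \<omega> * p j \<omega>)) =
      \<tau>\<^sup>2 * real (card (leaves v)) + \<mu>\<^sup>2 * (real (card (leaves v)))\<^sup>2" for v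
    unfolding prod_exp by (rule sum_sum_diagonal_plus_const) simp
  have node: "expectation (\<lambda>\<omega>. (partial_sum (\<lambda>i. p i \<omega>) v)\<^sup>2) =
      \<tau>\<^sup>2 * real (card (leaves v)) + \<mu>\<^sup>2 * (real (card (leaves v)))\<^sup>2" for v
    unfolding sq_sum entries[symmetric] by (simp add: prod_int)
  have "frob_inner (ca_kernel T) (second_moment_matrix P p) = \<tau>\<^sup>2 * Lambda1 T + \<mu>\<^sup>2 * Lambda2 T"
    by (simp add: frob_inner_ca_kernel second_moment_matrix_def entries Lambda1_def Lambda2_def
        sum.distrib sum_distrib_left)
  \<comment> \<open>Linearity of the integral over finite sums relies on the integrability of each
    squared leaf and each squared partial sum.\<close>
  moreover have "leading_second_moment nu_p u_p nu_a u_a T P p =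
      (\<Sum>i\<in>UNIV. nu_p * u_p\<^sup>2 * expectation (\<lambda>\<omega>. (p i \<omega>)\<^sup>2)) +
      (\<Sum>v\<in>int_nodes T. nu_a * u_a\<^sup>2 * expectation (\<lambda>\<omega>. (partial_sum (\<lambda>i. p i \<omega>) v)\<^sup>2))"
    unfolding leading_second_moment_def root_error_moment_def rounding_var_def
    by (simp add: square_integrable node_int)
  ultimately show ?thesis
    by (simp add: leaf node Lambda1_def Lambda2_def sum.distrib sum_distrib_left distrib_left
        mult.assoc mult.left_commute)
qed

end
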